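(* Let $(X,d,\mu)$ be a space of homogeneous type. Let $\nu$ be a Borel measure on $X$ such that $M_\mu\nu(x)<\infty$ for $\mu$-almost every $x\in X$. Then $(M_\mu\nu)^\gamma\in A_1(X,d,\mu)$ for every $0\le\gamma<1$.
   Context: A quasi-distance on a set $X$ is a non-negative symmetric function $d$ on $X\times X$ with $d(x,y)=0$ iff $x=y$ and $d(x,y)\le K(d(x,z)+d(z,y))$ for all $x,y,z$, for some constant $K\ge1$. Balls are $B(x,r)=\{y\in X: d(x,y)<r\}$; they generate the topology of $X$, and it is assumed throughout that all balls are open sets. $(X,d,\mu)$ is a space of homogeneous type if $d$ is a quasi-distance on $X$ and $\mu$ is a non-negative Borel measure such that, for some constant $A$, $0<\mu(B(x,2r))\le A\,\mu(B(x,r))<\infty$ for every $x\in X$ and $r>0$. For a non-negative Borel measure $\nu$ such that every ball has finite $\nu$-measure, $M_\mu\nu(x)=\sup_{r>0}\frac{\nu(B(x,r))}{\mu(B(x,r))}$. A weight $w$ on $X$ is a non-negative function that is $\mu$-integrable over every ball; $w\in A_1(X,d,\mu)$ means that $w$ is a weight and there is a constant $C$ with $\frac1{\mu(B)}\int_B w\,d\mu\le C\,w(x)$ for every ball $B$ and $\mu$-almost every $x\in B$. *)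

theory Defs
  imports "HOL-Analysis.Analysis"
begin

definition quasi_distance :: "'a set \<Rightarrow> ('a \<Rightarrow> 'a \<Rightarrow> real) \<Rightarrow> bool" where
  "quasi_distance X d \<longleftrightarrow>
     (\<forall>x\<in>X. \<forall>y\<in>X. 0 \<le> d x y) \<and>
     (\<forall>x\<in>X. \<forall>y\<in>X. d x y = d y x) \<and>
     (\<forall>x\<in>X. \<forall>y\<in>X. d x y = 0 \<longleftrightarrow> x = y) \<and>
     (\<exists>K\<ge>1. \<forall>x\<in>X. \<forall>y\<in>X. \<forall>z\<in>X. d x y \<le> K * (d x z + d z y))"

definition qball :: "'a set \<Rightarrow> ('a \<Rightarrow> 'a \<Rightarrow> real) \<Rightarrow> 'a \<Rightarrow> real \<Rightarrow> 'a set" where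
  "qball X d x r = {y \<in> X. d x y < r}"

text \<open>
  The topology determined by the balls: a set is open iff it contains a ball around each of its
  points. For a general quasi-distance balls need not be open in it; when they are, it is the
  topology having the balls as a subbasis (lemma \<open>qtopology_eq_generated\<close>).
\<close>
definition qtopology :: "'a set \<Rightarrow> ('a \<Rightarrow> 'a \<Rightarrow> real) \<Rightarrow> 'a topology" where
  "qtopology X d = topology (\<lambda>U. U \<subseteq> X \<and> (\<forall>x\<in>U. \<exists>r>0. qball X d x r \<subseteq> U))"

lemma openin_qtopology:
  "openin (qtopology X d) U \<longleftrightarrow> U \<subseteq> X \<and> (\<forall>x\<in>U. \<exists>r>0. qball X d x r \<subseteq> U)"
proof -
  have "istopology (\<lambda>U. U \<subseteq> X \<and> (\<forall>x\<in>U. \<exists>r>0. qball X d x r \<subseteq> U))"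
    unfolding istopology_def
  proof (intro conjI allI impI)
    fix S T
    assume S: "S \<subseteq> X \<and> (\<forall>x\<in>S. \<exists>r>0. qball X d x r \<subseteq> S)"
      and T: "T \<subseteq> X \<and> (\<forall>x\<in>T. \<exists>r>0. qball X d x r \<subseteq> T)"
    show "S \<inter> T \<subseteq> X" using S by blast
    show "\<forall>x\<in>S \<inter> T. \<exists>r>0. qball X d x r \<subseteq> S \<inter> T"
    proof
      fix x assume "x \<in> S \<inter> T"
      then obtain r s where r: "r > 0" "qball X d x r \<subseteq> S" and s: "s > 0" "qball X d x s \<subseteq> T"
        using S T by blast
      have "qball X d x (min r s) \<subseteq> qball X d x r \<inter> qball X d x s"
        unfolding qball_def by auto
      moreover have "min r s > 0" using r s by simp
      ultimately show "\<exists>r>0. qball X d x r \<subseteq> S \<inter> T"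
        using r s by (intro exI[of _ "min r s"]) blast
    qed
  next
    fix \<K>
    assume K: "\<forall>U\<in>\<K>. U \<subseteq> X \<and> (\<forall>x\<in>U. \<exists>r>0. qball X d x r \<subseteq> U)"
    then show "\<Union>\<K> \<subseteq> X" by blast
    show "\<forall>x\<in>\<Union>\<K>. \<exists>r>0. qball X d x r \<subseteq> \<Union>\<K>"
    proof
      fix x assume "x \<in> \<Union>\<K>"
      then obtain U where U: "U \<in> \<K>" "x \<in> U" by blast
      then obtain r where "r > 0" "qball X d x r \<subseteq> U" using K by blast
      with U show "\<exists>r>0. qball X d x r \<subseteq> \<Union>\<K>" by blast
    qed
  qed
  then show ?thesis
    unfolding qtopology_def by (simp add: topology_inverse')
qed

lemma qtopology_eq_generated:
  assumes d: "quasi_distance X d"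
    and op: "\<And>x r. x \<in> X \<Longrightarrow> 0 < r \<Longrightarrow> openin (qtopology X d) (qball X d x r)"
  shows "qtopology X d = topology_generated_by {qball X d x r | x r. x \<in> X \<and> 0 < r}"
proof -
  define B where "B = {qball X d x r | x r. x \<in> X \<and> 0 < r}"
  have 1: "openin (topology_generated_by B) U" if U: "openin (qtopology X d) U" for U
  proof (subst openin_subopen, intro ballI)
    fix x assume x: "x \<in> U"
    obtain r where r: "r > 0" "qball X d x r \<subseteq> U"
      using U x unfolding openin_qtopology by metis
    have "x \<in> X"
      using U x unfolding openin_qtopology by auto
    have "qball X d x r \<in> B"
      unfolding B_def using \<open>x \<in> X\<close> r(1) by auto
    then have "openin (topology_generated_by B) (qball X d x r)"
      by (rule topology_generated_by_Basis)
    moreover have "d x x = 0"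
      using d \<open>x \<in> X\<close> unfolding quasi_distance_def by simp
    then have "x \<in> qball X d x r"
      using r(1) \<open>x \<in> X\<close> unfolding qball_def by simp
    ultimately show "\<exists>T. openin (topology_generated_by B) T \<and> x \<in> T \<and> T \<subseteq> U"
      using r(2) by (intro exI[of _ "qball X d x r"] conjI)
  qed
  have 2: "openin (qtopology X d) U" if "generate_topology_on B U" for U
    using that
  proof (induction rule: generate_topology_on.induct)
    case Empty
    show ?case by (rule openin_empty)
  next
    case (Int S T)
    show ?case using Int.IH by (rule openin_Int)
  next
    case (UN K)
    show ?case using UN.IH by (rule openin_Union)
  next
    case (Basis S)
    then show ?case unfolding B_def using op by auto
  qed
  have "openin (qtopology X d) = openin (topology_generated_by B)"
    using 1 2 by (intro ext) (metis openin_topology_generated_by)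
  then show ?thesis
    unfolding B_def by (simp add: openin_inject)
qed

definition qborel :: "'a set \<Rightarrow> ('a \<Rightarrow> 'a \<Rightarrow> real) \<Rightarrow> 'a measure" where
  "qborel X d = sigma X {U. openin (qtopology X d) U}"

definition borel_measure_on :: "'a set \<Rightarrow> ('a \<Rightarrow> 'a \<Rightarrow> real) \<Rightarrow> 'a measure \<Rightarrow> bool" where
  "borel_measure_on X d \<nu> \<longleftrightarrow> sets \<nu> = sets (qborel X d)"

text \<open>Equality of the sigma-algebras also fixes the underlying set.\<close>
lemma space_borel_measure_on: "borel_measure_on X d \<nu> \<Longrightarrow> space \<nu> = X"
  unfolding borel_measure_on_def qborel_def
  by (drule sets_eq_imp_space_eq) (simp add: space_measure_of_conv)

definition homogeneous_type :: "'a set \<Rightarrow> ('a \<Rightarrow> 'a \<Rightarrow> real) \<Rightarrow> 'a measure \<Rightarrow> bool" where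
  "homogeneous_type X d \<mu> \<longleftrightarrow>
     quasi_distance X d \<and>
     borel_measure_on X d \<mu> \<and>
     (\<exists>A::real. \<forall>x\<in>X. \<forall>r>0.
        0 < emeasure \<mu> (qball X d x (2 * r)) \<and>
        emeasure \<mu> (qball X d x (2 * r)) \<le> ennreal A * emeasure \<mu> (qball X d x r) \<and>
        ennreal A * emeasure \<mu> (qball X d x r) < \<infinity>)"

definition maximal_function ::
  "'a set \<Rightarrow> ('a \<Rightarrow> 'a \<Rightarrow> real) \<Rightarrow> 'a measure \<Rightarrow> 'a measure \<Rightarrow> 'a \<Rightarrow> ennreal" where
  "maximal_function X d \<mu> \<nu> x =
     (SUP r\<in>{0<..}. emeasure \<nu> (qball X d x r) / emeasure \<mu> (qball X d x r))"

text \<open>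
  Powers of extended non-negative reals with exponent \<open>p \<ge> 0\<close>. The case \<open>p = 0\<close> is separate
  because \<open>0 powr 0 = 0\<close> for reals; here \<open>x\<^sup>0 = 1\<close> for every \<open>x\<close>, and \<open>\<infinity>\<^sup>p = \<infinity>\<close> for \<open>p > 0\<close>.
\<close>
definition ennreal_powr :: "ennreal \<Rightarrow> real \<Rightarrow> ennreal" where
  "ennreal_powr x p =
     (if p = 0 then 1 else if x = \<infinity> then \<infinity> else ennreal (enn2real x powr p))"

text \<open>Weights may take the value \<open>\<infinity>\<close>, necessarily only on a null set.\<close>
definition weight :: "'a set \<Rightarrow> ('a \<Rightarrow> 'a \<Rightarrow> real) \<Rightarrow> 'a measure \<Rightarrow> ('a \<Rightarrow> ennreal) \<Rightarrow> bool" where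
  "weight X d \<mu> w \<longleftrightarrow>
     w \<in> borel_measurable \<mu> \<and>
     (\<forall>x\<in>X. \<forall>r>0. (\<integral>\<^sup>+y\<in>qball X d x r. w y \<partial>\<mu>) < \<infinity>)"

definition A1 :: "'a set \<Rightarrow> ('a \<Rightarrow> 'a \<Rightarrow> real) \<Rightarrow> 'a measure \<Rightarrow> ('a \<Rightarrow> ennreal) set" where
  "A1 X d \<mu> = {w. weight X d \<mu> w \<and>
     (\<exists>C\<ge>0::real. \<forall>x\<in>X. \<forall>r>0. AE y in \<mu>. y \<in> qball X d x r \<longrightarrow>
        (\<integral>\<^sup>+z\<in>qball X d x r. w z \<partial>\<mu>) / emeasure \<mu> (qball X d x r) \<le> ennreal C * w y)}"

end

theory Submission
  imports Defs
begin

text \<open>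
  The idea is that, on a ball \<open>B\<close> of radius \<open>r\<close>, the maximal function is the larger of a local part,
  where the supremum runs over radii below \<open>r\<close>, and a part with radii at least \<open>r\<close>.

  The second part varies little over \<open>B\<close>: if \<open>y, z \<in> B\<close>, a ball about \<open>z\<close> of radius
  \<open>\<rho> \<ge> r\<close> lies in a comparable ball about \<open>y\<close>, whose \<open>\<mu>\<close>-measure is larger by at most a constant
  factor because \<open>\<mu>\<close> is doubling. So the large-radius part at \<open>z\<close> is at most a constant times
  \<open>M\<^sub>\<mu>\<nu>(y)\<close> (\<open>ball_ratio_le_maximal_function\<close>).

  The local part on \<open>B\<close> only sees \<open>\<nu>\<close> on a fixed dilate \<open>B\<^sup>*\<close> of \<open>B\<close>. By a Vitali covering argument
  (\<open>Vitali_selection\<close>) it satisfies the weak type bound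
  \<open>t \<mu>{z \<in> B. local part > t} \<le> D \<nu>(B\<^sup>*)\<close> (\<open>weak_type_local_maximal\<close>).
  Kolmogorov's inequality turns this into a bound on the average over \<open>B\<close> of the power \<open>\<gamma>\<close> of the
  local part by a multiple of \<open>(\<nu>(B\<^sup>*)/\<mu>(B))\<^sup>\<gamma>\<close>; it is here that \<open>\<gamma> < 1\<close> matters, as a function in weak
  \<open>L\<^sup>1\<close> on a set of finite measure is in general integrable
  to powers below one only. Finally \<open>\<nu>(B\<^sup>*)/\<mu>(B)\<close> is
  itself at most a multiple of \<open>M\<^sub>\<mu>\<nu>(y)\<close>.

  The resulting inequality holds for every \<open>y \<in> B\<close> (\<open>maximal_function_powr_average_le\<close>). Finiteness
  of \<open>M\<^sub>\<mu>\<nu>\<close> almost everywhere enters once: every ball contains a point \<open>y\<close> with a finite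
  right-hand side, hence the power is integrable over balls. Measurability of the maximal function
  uses that balls are open, which makes \<open>x \<mapsto> \<nu>(B(x,r))\<close> lower semicontinuous.
\<close>

section \<open>Covering and countability\<close>

text \<open>
  A largest remaining member need not exist and the family may be uncountable, so instead of a
  greedy selection Zorn's lemma is applied to the disjoint subfamilies \<open>J\<close> that are already
  adequate for all members meeting one of theirs. If a maximal \<open>J\<close> missed some members, one of
  nearly largest size among those could be added.
\<close>
lemma Vitali_selection:
  fixes B :: "'i \<Rightarrow> 'a set" and \<rho> :: "'i \<Rightarrow> real"
  assumes pos: "\<And>i. i \<in> I \<Longrightarrow> 0 < \<rho> i" and bdd: "bdd_above (\<rho> ` I)"
    and ne: "\<And>i. i \<in> I \<Longrightarrow> B i \<noteq> {}"
  obtains J where "J \<subseteq> I" "disjoint_family_on B J"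
    "\<And>i. i \<in> I \<Longrightarrow> \<exists>j\<in>J. B i \<inter> B j \<noteq> {} \<and> \<rho> i \<le> 2 * \<rho> j"
proof -
  define good where "good J \<longleftrightarrow> J \<subseteq> I \<and> disjoint_family_on B J \<and>
     (\<forall>i\<in>I. (\<exists>j\<in>J. B i \<inter> B j \<noteq> {}) \<longrightarrow> (\<exists>j\<in>J. B i \<inter> B j \<noteq> {} \<and> \<rho> i \<le> 2 * \<rho> j))" for J
  have "\<exists>J\<in>Collect good. \<forall>J'\<in>Collect good. J \<subseteq> J' \<longrightarrow> J' = J"
  proof (rule subset_Zorn_nonempty)
    have "good {}" by (auto simp: good_def disjoint_family_on_def)
    then show "Collect good \<noteq> {}" by blast
    fix \<C> assume "subset.chain (Collect good) \<C>"
    then have good: "\<And>J. J \<in> \<C> \<Longrightarrow> good J"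
      and chain: "\<And>J J'. J \<in> \<C> \<Longrightarrow> J' \<in> \<C> \<Longrightarrow> J \<subseteq> J' \<or> J' \<subseteq> J"
      by (auto simp: subset_chain_def)
    have "disjoint_family_on B (\<Union>\<C>)"
      unfolding disjoint_family_on_def
    proof (intro ballI impI)
      fix i j assume "i \<in> \<Union>\<C>" "j \<in> \<Union>\<C>" "i \<noteq> j"
      then obtain J where "J \<in> \<C>" "i \<in> J" "j \<in> J"
        using chain by blast
      then show "B i \<inter> B j = {}"
        using good \<open>i \<noteq> j\<close> unfolding good_def disjoint_family_on_def by blast
    qed
    moreover have "\<exists>j\<in>\<Union>\<C>. B i \<inter> B j \<noteq> {} \<and> \<rho> i \<le> 2 * \<rho> j"
      if "i \<in> I" "j \<in> \<Union>\<C>" "B i \<inter> B j \<noteq> {}" for i j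
    proof -
      obtain J where "J \<in> \<C>" "j \<in> J" using \<open>j \<in> \<Union>\<C>\<close> by blast
      then have "\<exists>j\<in>J. B i \<inter> B j \<noteq> {} \<and> \<rho> i \<le> 2 * \<rho> j"
        using good[of J] that(1,3) unfolding good_def by blast
      then show ?thesis using \<open>J \<in> \<C>\<close> by blast
    qed
    moreover have "\<Union>\<C> \<subseteq> I"
      using good unfolding good_def by blast
    ultimately show "\<Union>\<C> \<in> Collect good"
      unfolding good_def by blast
  qed
  then obtain J where J: "good J" and max: "\<And>J'. good J' \<Longrightarrow> J \<subseteq> J' \<Longrightarrow> J' = J"
    by auto
  define R where "R = {i \<in> I. \<forall>j\<in>J. B i \<inter> B j = {}}"
  have "R = {}"
  proof (rule ccontr)
    assume R: "R \<noteq> {}"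
    have bddR: "bdd_above (\<rho> ` R)"
      by (rule bdd_above_mono[OF bdd]) (auto simp: R_def)
    have "0 < Sup (\<rho> ` R)"
      using R pos bddR by (auto simp: R_def less_cSup_iff)
    \<comment> \<open>Any member larger than half the supremum over the missed ones can be added to \<open>J\<close>.\<close>
    then have "Sup (\<rho> ` R) / 2 < Sup (\<rho> ` R)" by simp
    then obtain k where k: "k \<in> R" "Sup (\<rho> ` R) / 2 < \<rho> k"
      using R bddR by (subst (asm) less_cSup_iff) auto
    have large: "\<rho> i \<le> 2 * \<rho> k" if "i \<in> R" for i
      using cSup_upper[OF imageI[OF that] bddR] k(2) by simp
    have "good (insert k J)"
      unfolding good_def
    proof (intro conjI ballI impI)
      show "insert k J \<subseteq> I" using J k(1) by (auto simp: good_def R_def)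
      show "disjoint_family_on B (insert k J)"
        using J k(1) by (auto simp: good_def R_def disjoint_family_on_def)
      fix i assume "i \<in> I" "\<exists>j\<in>insert k J. B i \<inter> B j \<noteq> {}"
      show "\<exists>j\<in>insert k J. B i \<inter> B j \<noteq> {} \<and> \<rho> i \<le> 2 * \<rho> j"
      proof (cases "i \<in> R")
        case True
        then have "B i \<inter> B k \<noteq> {}"
          using \<open>\<exists>j\<in>insert k J. B i \<inter> B j \<noteq> {}\<close> by (auto simp: R_def)
        then show ?thesis using large[OF True] by blast
      next
        case False
        then have "\<exists>j\<in>J. B i \<inter> B j \<noteq> {}"
          using \<open>i \<in> I\<close> by (auto simp: R_def)
        then have "\<exists>j\<in>J. B i \<inter> B j \<noteq> {} \<and> \<rho> i \<le> 2 * \<rho> j"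
          using J \<open>i \<in> I\<close> unfolding good_def by blast
        then show ?thesis by blast
      qed
    qed
    then have "insert k J = J" using max by blast
    then have "k \<in> J" by blast
    then have "B k = {}" using k(1) by (auto simp: R_def)
    then show False using ne k(1) by (auto simp: R_def)
  qed
  then have "\<exists>j\<in>J. B i \<inter> B j \<noteq> {}" if "i \<in> I" for i
    using that unfolding R_def by blast
  then show thesis
    using J that[of J] unfolding good_def by blast
qed

text \<open>
  All finite partial sums of the positive numbers \<open>measure M (B i)\<close> are bounded by that of \<open>S\<close>, so
  there are countably many. Applied to disjoint balls inside one large ball, this makes the Vitali
  selection countable.
\<close>
lemma countable_disjoint_family_pos_measure:
  assumes sets: "\<And>i. i \<in> I \<Longrightarrow> B i \<in> sets M" and disj: "disjoint_family_on B I"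
    and pos: "\<And>i. i \<in> I \<Longrightarrow> 0 < emeasure M (B i)"
    and sub: "\<And>i. i \<in> I \<Longrightarrow> B i \<subseteq> S" and S: "S \<in> sets M" "emeasure M S < \<infinity>"
  shows "countable I"
proof -
  have fin: "emeasure M (B i) < \<infinity>" if "i \<in> I" for i
    using emeasure_mono[OF sub[OF that] S(1)] S(2) by (rule order.strict_trans1)
  have "(\<Sum>i\<in>F. measure M (B i)) \<le> measure M S" if F: "F \<subseteq> I" "finite F" for F
  proof -
    have "(\<Sum>i\<in>F. measure M (B i)) = measure M (\<Union>i\<in>F. B i)"
      using F sets fin disj
      by (intro measure_finite_Union[symmetric])
        (auto simp: less_top[symmetric] disjoint_family_on_def image_subset_iff subset_eq)
    also have "\<dots> \<le> measure M S"
      using F sub S sets by (intro measure_mono_fmeasurable fmeasurableI) (auto intro!: sets.finite_UN)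
    finally show ?thesis .
  qed
  then have "(\<lambda>i. measure M (B i)) summable_on I"
    by (intro nonneg_bdd_above_summable_on) (auto simp: bdd_above_def)
  then have "countable {i \<in> I. measure M (B i) \<noteq> 0}"
    by (rule summable_countable_real)
  moreover have "{i \<in> I. measure M (B i) \<noteq> 0} = I"
    using pos fin by (fastforce simp: measure_def enn2real_eq_0_iff)
  ultimately show ?thesis by simp
qed

lemma emeasure_UN_countable_le:
  assumes "\<And>i. i \<in> I \<Longrightarrow> B i \<in> sets M" "countable I"
  shows "emeasure M (\<Union>i\<in>I. B i) \<le> (\<integral>\<^sup>+i. emeasure M (B i) \<partial>count_space I)"
proof -
  have "emeasure M (\<Union>i\<in>I. B i) = (\<integral>\<^sup>+x. indicator (\<Union>i\<in>I. B i) x \<partial>M)"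
    using assms by (intro nn_integral_indicator[symmetric] sets.countable_UN') auto
  also have "\<dots> \<le> (\<integral>\<^sup>+x. \<integral>\<^sup>+i. indicator (B i) x \<partial>count_space I \<partial>M)"
  proof (rule nn_integral_mono)
    fix x
    show "indicator (\<Union>i\<in>I. B i) x \<le> (\<integral>\<^sup>+i. indicator (B i) x \<partial>count_space I)"
    proof (cases "x \<in> (\<Union>i\<in>I. B i)")
      case True
      then obtain j where "j \<in> I" "x \<in> B j" by blast
      then show ?thesis
        using nn_integral_ge_point[of j I "\<lambda>i. indicator (B i) x"]
        by (simp only: indicator_simps True)
    qed simp
  qed
  also have "\<dots> = (\<integral>\<^sup>+i. \<integral>\<^sup>+x. indicator (B i) x \<partial>M \<partial>count_space I)"
    using assms by (intro nn_integral_count_space_nn_integral) auto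
  also have "\<dots> = (\<integral>\<^sup>+i. emeasure M (B i) \<partial>count_space I)"
    using assms by (intro nn_integral_cong) simp
  finally show ?thesis .
qed

section \<open>Powers and Kolmogorov's inequality\<close>

lemma divide_le_ennreal_iff:
  fixes a b s :: ennreal
  assumes "0 < b" "b < \<infinity>"
  shows "a / b \<le> s \<longleftrightarrow> a \<le> s * b"
proof -
  have "b \<noteq> 0" "b < top" using assms by auto
  then have "a / b * b = a"
    by (simp add: ennreal_divide_times)
  then show ?thesis
    using assms divide_le_posI_ennreal[of b a s] mult_right_mono[of "a / b" s b]
    by (auto simp: mult.commute)
qed

lemma ennreal_powr_ennreal:
  "0 < p \<Longrightarrow> 0 \<le> v \<Longrightarrow> ennreal_powr (ennreal v) p = ennreal (v powr p)"
  by (simp add: ennreal_powr_def)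

lemma ennreal_powr_mono:
  assumes "0 \<le> p" "x \<le> y"
  shows "ennreal_powr x p \<le> ennreal_powr y p"
  using assms by (cases x; cases y) (auto simp: ennreal_powr_def top_unique powr_mono2)

lemma ennreal_powr_max_le:
  "ennreal_powr (max x y) p \<le> ennreal_powr x p + ennreal_powr y p"
  by (auto simp: max_def intro: add_increasing add_increasing2)

lemma ennreal_powr_mult_left:
  assumes "0 < a"
  shows "ennreal_powr (ennreal a * x) p = ennreal (a powr p) * ennreal_powr x p"
proof (cases x)
  case (real v)
  then show ?thesis
    using assms by (simp add: ennreal_powr_def ennreal_mult[symmetric] powr_mult powr_zero_eq_one)
next
  case top
  then show ?thesis
    using assms by (simp add: ennreal_powr_def ennreal_mult_top)
qed

lemma borel_measurable_ennreal_powr [measurable]: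
  assumes [measurable]: "f \<in> borel_measurable M"
  shows "(\<lambda>x. ennreal_powr (f x) p) \<in> borel_measurable M"
  unfolding ennreal_powr_def by measurable

lemma ennreal_suminf_top:
  fixes g :: "nat \<Rightarrow> ennreal"
  assumes "0 < c" "\<And>k. ennreal c \<le> g k"
  shows "(\<Sum>k. g k) = \<infinity>"
proof (rule ccontr)
  assume "(\<Sum>k. g k) \<noteq> \<infinity>"
  then obtain s where s: "(\<Sum>k. g k) = ennreal s" "0 \<le> s"
    by (cases "\<Sum>k. g k") auto
  obtain n :: nat where n: "s < real n * c"
    using reals_Archimedean3[OF \<open>0 < c\<close>] by blast
  have "ennreal (real n * c) = (\<Sum>k<n. ennreal c)"
    using \<open>0 < c\<close> by (simp add: ennreal_mult ennreal_of_nat_eq_real_of_nat)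
  also have "\<dots> \<le> (\<Sum>k<n. g k)" by (intro sum_mono assms)
  also have "\<dots> \<le> (\<Sum>k. g k)" by (intro sum_le_suminf) auto
  finally show False using n s by simp
qed

text \<open>
  For \<open>u > L\<close>, the term with \<open>2\<^sup>k L < u \<le> 2\<^sup>k\<^sup>+\<^sup>1 L\<close> alone dominates. At \<open>u = \<infinity>\<close> no such \<open>k\<close>
  exists, but there all terms are bounded below and the sum diverges.
\<close>
lemma ennreal_powr_le_dyadic_sum:
  assumes L: "0 < L" and p: "0 < p"
  shows "ennreal_powr u p \<le> ennreal (L powr p) +
    (\<Sum>k. ennreal ((2 ^ Suc k * L) powr p) * of_bool (ennreal (2 ^ k * L) < u))"
    (is "_ \<le> _ + (\<Sum>k. ?g k)")
proof (cases u)
  case top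
  have "(\<Sum>k. ?g k) = \<infinity>"
  proof (rule ennreal_suminf_top)
    show "0 < L powr p" using L by simp
    fix k
    have "1 * L \<le> 2 ^ Suc k * L"
      using L by (intro mult_right_mono one_le_power) auto
    then have "L powr p \<le> (2 ^ Suc k * L) powr p"
      using L p by (intro powr_mono2) auto
    then show "ennreal (L powr p) \<le> ?g k"
      by (simp add: top ennreal_leI)
  qed
  then show ?thesis by simp
next
  case (real v)
  show ?thesis
  proof (cases "v \<le> L")
    case True
    then show ?thesis
      using real p L by (auto simp: ennreal_powr_ennreal intro!: add_increasing2 ennreal_leI powr_mono2)
  next
    case False
    obtain m :: nat where "v / L < 2 ^ m"
      using real_arch_pow[of 2 "v / L"] by auto
    then have ex: "\<exists>m. v \<le> 2 ^ m * L"
      using L by (auto simp: field_simps intro!: exI[of _ m])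
    define n where "n = (LEAST m. v \<le> 2 ^ m * L)"
    have n: "v \<le> 2 ^ n * L" unfolding n_def by (rule LeastI_ex[OF ex])
    have "n \<noteq> 0" using n False by (intro notI) simp
    then obtain k where k: "n = Suc k" using not0_implies_Suc by blast
    have "\<not> v \<le> 2 ^ k * L"
      using not_less_Least[of k "\<lambda>m. v \<le> 2 ^ m * L"] k unfolding n_def by simp
    then have lt: "ennreal (2 ^ k * L) < u"
      using real L by (simp add: ennreal_less_iff)
    have "ennreal_powr u p \<le> ?g k"
      using lt n real p unfolding k by (auto simp: ennreal_powr_ennreal intro!: ennreal_leI powr_mono2)
    also have "\<dots> \<le> (\<Sum>k. ?g k)"
      using sum_le_suminf[of ?g "{k}"] by (simp only: summableI finite.intros sum.insert sum.empty
          empty_iff not_False_eq_True add_0_right zero_le)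
    finally show ?thesis by (simp add: add_increasing)
  qed
qed

text \<open>
  At level \<open>2\<^sup>k L\<close> the weak type bound gives a set of measure at most \<open>C 2\<^sup>-\<^sup>k\<close> times that of \<open>S\<close>,
  while \<open>f\<^sup>p\<close> has size about \<open>2\<^sup>k\<^sup>p L\<^sup>p\<close> there. The dyadic pieces therefore add up to a geometric
  series with ratio \<open>2\<^sup>p\<^sup>-\<^sup>1\<close>, which converges because \<open>p < 1\<close>.
\<close>
lemma Kolmogorov_inequality:
  fixes f :: "'a \<Rightarrow> ennreal" and L C p :: real
  assumes f [measurable]: "f \<in> borel_measurable M"
    and S [measurable]: "S \<in> sets M" and fin: "emeasure M S < \<infinity>"
    and p: "0 < p" "p < 1" and L: "0 < L" and C: "0 \<le> C"
    and weak: "\<And>t. 0 < t \<Longrightarrow>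
      ennreal t * emeasure M {x \<in> S. ennreal t < f x} \<le> ennreal (C * L) * emeasure M S"
  shows "(\<integral>\<^sup>+x\<in>S. ennreal_powr (f x) p \<partial>M)
    \<le> ennreal ((1 + C * 2 powr p / (1 - 2 powr (p - 1))) * L powr p) * emeasure M S"
proof -
  define q where "q = (2::real) powr (p - 1)"
  have q: "0 < q" "q < 1"
    using p powr_less_mono[of "p - 1" 0 2] by (auto simp: q_def)
  obtain m where m: "emeasure M S = ennreal m" "0 \<le> m"
    using fin by (cases "emeasure M S") auto
  define E where "E k = {x \<in> S. ennreal (2 ^ k * L) < f x}" for k
  have E [measurable]: "E k \<in> sets M" for k
  proof -
    have "E k = {x \<in> space M. ennreal (2 ^ k * L) < f x} \<inter> S"
      using sets.sets_into_space[OF S] by (auto simp: E_def)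
    then show ?thesis by simp
  qed
  define a where "a k = ennreal ((2 ^ Suc k * L) powr p)" for k
  have term_le: "a k * emeasure M (E k) \<le> ennreal (C * 2 powr p * L powr p * m * q ^ k)" for k
  proof -
    have t: "0 < 2 ^ k * L" using L by simp
    have "emeasure M (E k) \<le> emeasure M S"
      by (intro emeasure_mono) (auto simp: E_def)
    then obtain e where e: "emeasure M (E k) = ennreal e" "0 \<le> e"
      using fin by (cases "emeasure M (E k)") (auto simp: top_unique)
    have "ennreal (2 ^ k * L * e) \<le> ennreal (C * L * m)"
      using weak[OF t] t e m C L unfolding E_def[symmetric] by (simp add: ennreal_mult[symmetric])
    then have "L * (2 ^ k * e) \<le> L * (C * m)"
      using m C L by (simp add: ennreal_le_iff mult_ac)
    then have le: "e \<le> C * m / 2 ^ k" using L by (simp add: field_simps)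
    have pw: "(2 ^ Suc k * L) powr p = 2 powr p * L powr p * (2 ^ k * q ^ k)"
    proof -
      have "(2 ^ Suc k :: real) powr p = (2 powr p) ^ Suc k"
        by (simp only: powr_realpow[symmetric] powr_powr mult.commute powr_gt_zero zero_less_numeral
            zero_neq_numeral[symmetric] not_False_eq_True)
      then have "(2 ^ Suc k * L) powr p = (2 powr p) ^ Suc k * L powr p"
        using L by (simp add: powr_mult)
      also have "2 powr p = 2 * q"
        by (simp add: q_def powr_diff)
      finally show ?thesis by (simp add: power_mult_distrib mult_ac \<open>2 powr p = 2 * q\<close>)
    qed
    have "(2 ^ Suc k * L) powr p * e \<le> (2 ^ Suc k * L) powr p * (C * m / 2 ^ k)"
      by (intro mult_left_mono le) auto
    also have "\<dots> = C * 2 powr p * L powr p * m * q ^ k"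
      unfolding pw by (simp add: field_simps)
    finally show ?thesis
      unfolding a_def e by (simp add: ennreal_mult[symmetric] e ennreal_leI)
  qed
  have "(\<integral>\<^sup>+x\<in>S. ennreal_powr (f x) p \<partial>M)
      \<le> (\<integral>\<^sup>+x. ennreal (L powr p) * indicator S x + (\<Sum>k. a k * indicator (E k) x) \<partial>M)"
  proof (rule nn_integral_mono)
    fix x
    show "ennreal_powr (f x) p * indicator S x
      \<le> ennreal (L powr p) * indicator S x + (\<Sum>k. a k * indicator (E k) x)"
    proof (cases "x \<in> S")
      case True
      then have "(indicator (E k) x :: ennreal) = of_bool (ennreal (2 ^ k * L) < f x)" for k
        by (simp add: E_def indicator_def)
      then show ?thesis
        using ennreal_powr_le_dyadic_sum[OF L p(1), of "f x"] True by (simp add: a_def)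
    qed simp
  qed
  also have "\<dots> = ennreal (L powr p) * emeasure M S + (\<Sum>k. a k * emeasure M (E k))"
    by (subst nn_integral_add) (auto simp: nn_integral_suminf nn_integral_cmult_indicator)
  also have "(\<Sum>k. a k * emeasure M (E k)) \<le> (\<Sum>k. ennreal (C * 2 powr p * L powr p * m * q ^ k))"
    by (intro suminf_le term_le) auto
  also have "\<dots> = ennreal (C * 2 powr p * L powr p * m * (1 / (1 - q)))"
    using q C m by (intro suminf_ennreal_eq sums_mult geometric_sums) auto
  also have "ennreal (L powr p) * emeasure M S + ennreal (C * 2 powr p * L powr p * m * (1 / (1 - q)))
    = ennreal (L powr p * m + C * 2 powr p * L powr p * m * (1 / (1 - q)))"
    using m C q by (simp add: ennreal_mult[symmetric] ennreal_plus[symmetric] del: ennreal_plus)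
  also have "L powr p * m + C * 2 powr p * L powr p * m * (1 / (1 - q))
    = (1 + C * 2 powr p / (1 - q)) * L powr p * m"
    by (simp add: algebra_simps)
  also have "ennreal \<dots> = ennreal ((1 + C * 2 powr p / (1 - q)) * L powr p) * emeasure M S"
    using m C q by (simp add: ennreal_mult)
  finally show ?thesis unfolding q_def by simp
qed

section \<open>Balls in a doubling space\<close>

text \<open>
  A space of homogeneous type with open balls. The constants \<open>K\<close> and \<open>A\<close>, which
  \<open>homogeneous_type\<close> only asserts to exist, are fixed here so that the radii of dilated balls
  can be written down.
\<close>
locale doubling_space =
  fixes X :: "'a set" and d :: "'a \<Rightarrow> 'a \<Rightarrow> real" and \<mu> :: "'a measure" and K A :: real
  assumes dist_sym: "\<And>x y. x \<in> X \<Longrightarrow> y \<in> X \<Longrightarrow> d x y = d y x"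
    and dist_self: "\<And>x. x \<in> X \<Longrightarrow> d x x = 0"
    and dist_triangle: "\<And>x y z. x \<in> X \<Longrightarrow> y \<in> X \<Longrightarrow> z \<in> X \<Longrightarrow> d x y \<le> K * (d x z + d z y)"
    and K: "1 \<le> K"
    and ball_open: "\<And>x r. x \<in> X \<Longrightarrow> 0 < r \<Longrightarrow> openin (qtopology X d) (qball X d x r)"
    and sets_\<mu>: "sets \<mu> = sets (qborel X d)"
    and ball_pos: "\<And>x r. x \<in> X \<Longrightarrow> 0 < r \<Longrightarrow> 0 < emeasure \<mu> (qball X d x r)"
    and ball_finite: "\<And>x r. x \<in> X \<Longrightarrow> 0 < r \<Longrightarrow> emeasure \<mu> (qball X d x r) < \<infinity>"
    and doubling: "\<And>x r. x \<in> X \<Longrightarrow> 0 < r \<Longrightarrow>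
      emeasure \<mu> (qball X d x (2 * r)) \<le> ennreal A * emeasure \<mu> (qball X d x r)"
begin

abbreviation ball where "ball \<equiv> qball X d"

lemma ball_subset:
  assumes "x \<in> X" "y \<in> X" "d x y \<le> s" "K * (s + r) \<le> R"
  shows "ball x r \<subseteq> ball y R"
proof
  fix u assume u: "u \<in> ball x r"
  then have "d y u \<le> K * (d y x + d x u)"
    using dist_triangle[of y u x] assms(1,2) by (simp add: qball_def)
  also have "\<dots> < K * (s + r)"
    using u assms(1-3) K dist_sym[of x y] by (intro mult_strict_left_mono) (auto simp: qball_def)
  finally show "u \<in> ball y R"
    using u assms(4) by (simp add: qball_def)
qed

lemma ball_mono: "r \<le> s \<Longrightarrow> ball x r \<subseteq> ball x s"
  by (auto simp: qball_def)

lemma center_in_ball: "x \<in> X \<Longrightarrow> 0 < r \<Longrightarrow> x \<in> ball x r"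
  by (simp add: qball_def dist_self)

lemma open_sets:
  assumes "sets N = sets (qborel X d)" "openin (qtopology X d) U"
  shows "U \<in> sets N"
proof -
  have "{U. openin (qtopology X d) U} \<subseteq> Pow X"
    by (auto simp: openin_qtopology)
  then show ?thesis
    using assms by (simp add: qborel_def)
qed

lemma ball_sets:
  "sets N = sets (qborel X d) \<Longrightarrow> x \<in> X \<Longrightarrow> 0 < r \<Longrightarrow> ball x r \<in> sets N"
  by (intro open_sets ball_open)

lemma space_borel:
  "sets N = sets (qborel X d) \<Longrightarrow> space N = X"
  by (rule space_borel_measure_on) (simp add: borel_measure_on_def)

lemma doubling_dilation:
  obtains D where "0 < D" "\<And>x r. x \<in> X \<Longrightarrow> 0 < r \<Longrightarrow>
    emeasure \<mu> (ball x (c * r)) \<le> ennreal D * emeasure \<mu> (ball x r)"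
proof -
  obtain n :: nat where n: "c < 2 ^ n"
    using real_arch_pow[of 2 c] by auto
  have iter: "emeasure \<mu> (ball x (2 ^ m * r)) \<le> ennreal (max A 1 ^ m) * emeasure \<mu> (ball x r)"
    if "x \<in> X" "0 < r" for x r and m :: nat
  proof (induction m)
    case (Suc m)
    have "emeasure \<mu> (ball x (2 ^ Suc m * r)) \<le> ennreal A * emeasure \<mu> (ball x (2 ^ m * r))"
      using doubling[of x "2 ^ m * r"] that by (simp add: mult.assoc)
    also have "\<dots> \<le> ennreal (max A 1) * (ennreal (max A 1 ^ m) * emeasure \<mu> (ball x r))"
      by (intro mult_mono Suc.IH ennreal_leI) auto
    finally show ?case
      by (simp add: ennreal_mult mult.assoc)
  qed simp
  show thesis
  proof (rule that)
    show "0 < max A 1 ^ n" by simp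
    fix x r assume x: "x \<in> X" and r: "(0::real) < r"
    have "emeasure \<mu> (ball x (c * r)) \<le> emeasure \<mu> (ball x (2 ^ n * r))"
      using x r n by (intro emeasure_mono ball_mono ball_sets[OF sets_\<mu>]) auto
    also note iter[OF x r, of n]
    finally show "emeasure \<mu> (ball x (c * r)) \<le> ennreal (max A 1 ^ n) * emeasure \<mu> (ball x r)" .
  qed
qed

text \<open>
  If \<open>d x u < r\<close> then \<open>x\<close> lies in the open ball about \<open>u\<close>, so every sequence \<open>y\<^sub>n\<close> converging to \<open>x\<close>
  eventually satisfies \<open>d (y\<^sub>n) u < r\<close>. Hence the ball about \<open>x\<close> is contained in the limes inferior
  of the balls about \<open>y\<^sub>n\<close>, and continuity from below of the measure gives the claim. A general
  quasi-distance is not continuous; openness of balls does the work of continuity.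
\<close>
lemma emeasure_ball_lower_semicontinuous:
  assumes N: "sets N = sets (qborel X d)" and x: "x \<in> X" and r: "0 < r"
    and a: "a < emeasure N (ball x r)"
  shows "\<exists>\<delta>>0. \<forall>y\<in>ball x \<delta>. a < emeasure N (ball y r)"
proof (rule ccontr)
  assume "\<not> ?thesis"
  then have "\<forall>n. \<exists>y\<in>ball x (1 / real (Suc n)). emeasure N (ball y r) \<le> a"
    by (force simp: not_less)
  then obtain y where y: "\<And>n. y n \<in> ball x (1 / real (Suc n))"
    and small: "\<And>n. emeasure N (ball (y n) r) \<le> a"
    by metis
  have yX: "y n \<in> X" for n using y[of n] by (simp add: qball_def)
  define G where "G n = (\<Inter>m\<in>{n..}. ball (y m) r)" for n
  have sets: "range G \<subseteq> sets N"
    unfolding G_def using ball_sets[OF N yX r] by (auto intro!: sets.countable_INT')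
  have inc: "incseq G"
    by (rule incseq_SucI) (auto simp: G_def)
  have "ball x r \<subseteq> (\<Union>n. G n)"
  proof
    fix u assume u: "u \<in> ball x r"
    then have uX: "u \<in> X" and "x \<in> ball u r"
      using x by (auto simp: qball_def dist_sym)
    then obtain e where e: "0 < e" "ball x e \<subseteq> ball u r"
      using ball_open[OF uX r] unfolding openin_qtopology by blast
    obtain n where n: "1 / real (Suc n) < e"
      using nat_approx_posE[OF e(1)] by (metis of_nat_Suc)
    have "u \<in> ball (y m) r" if "n \<le> m" for m
    proof -
      have "1 / real (Suc m) \<le> 1 / real (Suc n)"
        using that by (simp add: frac_le)
      then have "y m \<in> ball u r"
        using y[of m] e(2) n ball_mono[of "1 / real (Suc m)" e x] by auto
      then show ?thesis using uX by (auto simp: qball_def dist_sym)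
    qed
    then show "u \<in> (\<Union>n. G n)" by (auto simp: G_def)
  qed
  then have "emeasure N (ball x r) \<le> emeasure N (\<Union>n. G n)"
    using sets by (intro emeasure_mono sets.countable_UN) auto
  also have "\<dots> = (SUP n. emeasure N (G n))"
    using SUP_emeasure_incseq[OF sets inc] by simp
  also have "\<dots> \<le> a"
  proof (rule SUP_least)
    fix n
    have "emeasure N (G n) \<le> emeasure N (ball (y n) r)"
      using ball_sets[OF N yX r] by (intro emeasure_mono) (auto simp: G_def)
    also note small
    finally show "emeasure N (G n) \<le> a" .
  qed
  finally show False using a by simp
qed

lemma borel_measurable_emeasure_ball:
  assumes N: "sets N = sets (qborel X d)" and r: "0 < r"
  shows "(\<lambda>x. emeasure N (ball x r)) \<in> borel_measurable \<mu>"
proof (rule borel_measurableI_greater)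
  fix a
  have "openin (qtopology X d) {x \<in> X. a < emeasure N (ball x r)}"
    unfolding openin_qtopology
  proof (intro conjI ballI)
    fix x assume "x \<in> {x \<in> X. a < emeasure N (ball x r)}"
    then obtain \<delta> where "0 < \<delta>" "\<forall>y\<in>ball x \<delta>. a < emeasure N (ball y r)"
      using emeasure_ball_lower_semicontinuous[OF N _ r] by blast
    then show "\<exists>\<delta>>0. ball x \<delta> \<subseteq> {x \<in> X. a < emeasure N (ball x r)}"
      by (intro exI[of _ \<delta>]) (auto simp: qball_def)
  qed auto
  then show "{x \<in> space \<mu>. a < emeasure N (ball x r)} \<in> sets \<mu>"
    using open_sets[OF sets_\<mu>] space_borel[OF sets_\<mu>] by simp
qed

lemma emeasure_ball_at_left:
  assumes N: "sets N = sets (qborel X d)" and x: "x \<in> X" and r: "0 < r"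
  shows "((\<lambda>\<rho>. emeasure N (ball x \<rho>)) \<longlongrightarrow> emeasure N (ball x r)) (at_left r)"
proof (rule tendsto_at_left_sequentially[OF r])
  fix S :: "nat \<Rightarrow> real"
  assume S: "\<And>n. S n < r" "\<And>n. 0 < S n" "incseq S" "S \<longlonglongrightarrow> r"
  have "(\<lambda>n. emeasure N (ball x (S n))) \<longlonglongrightarrow> emeasure N (\<Union>n. ball x (S n))"
  proof (rule Lim_emeasure_incseq)
    show "range (\<lambda>n. ball x (S n)) \<subseteq> sets N" using ball_sets[OF N x] S(2) by auto
    show "incseq (\<lambda>n. ball x (S n))" using S(3) by (auto simp: incseq_def intro!: ball_mono)
  qed
  also have "(\<Union>n. ball x (S n)) = ball x r"
  proof
    show "(\<Union>n. ball x (S n)) \<subseteq> ball x r"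
      using S(1) by (intro UN_least ball_mono less_imp_le)
    show "ball x r \<subseteq> (\<Union>n. ball x (S n))"
    proof
      fix u assume u: "u \<in> ball x r"
      then have "eventually (\<lambda>n. d x u < S n) sequentially"
        by (intro order_tendstoD(1)[OF S(4)]) (simp add: qball_def)
      then obtain n where "d x u < S n" by (auto simp: eventually_sequentially)
      then show "u \<in> (\<Union>n. ball x (S n))" using u by (auto simp: qball_def)
    qed
  qed
  finally show "(\<lambda>n. emeasure N (ball x (S n))) \<longlonglongrightarrow> emeasure N (ball x r)" .
qed

section \<open>Measurability of maximal functions\<close>

text \<open>
  The set \<open>I\<close> of admitted radii is a parameter so that the global maximal function
  (\<open>I = {0<..}\<close>) and the local one (\<open>I = {0<..<r}\<close>) share their measurability proof.
\<close>
definition maximal_over :: "real set \<Rightarrow> 'a measure \<Rightarrow> 'a \<Rightarrow> ennreal" where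
  "maximal_over I \<nu> x = (SUP r\<in>I. emeasure \<nu> (ball x r) / emeasure \<mu> (ball x r))"

lemma maximal_function_eq: "maximal_function X d \<mu> \<nu> = maximal_over {0<..} \<nu>"
  by (simp add: fun_eq_iff maximal_function_def maximal_over_def)

text \<open>
  Replacing \<open>r\<close> by a slightly smaller rational \<open>\<rho>\<close> loses little in the numerator, by left continuity,
  and can only decrease the denominator. Openness of \<open>I\<close> keeps \<open>\<rho>\<close> inside \<open>I\<close>.
\<close>
lemma maximal_over_Rats:
  assumes \<nu>: "sets \<nu> = sets (qborel X d)" and x: "x \<in> X" and I: "open I" "I \<subseteq> {0<..}"
  shows "maximal_over I \<nu> x = maximal_over (I \<inter> \<rat>) \<nu> x"
proof (rule antisym)
  show "maximal_over (I \<inter> \<rat>) \<nu> x \<le> maximal_over I \<nu> x"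
    unfolding maximal_over_def by (rule SUP_subset_mono) auto
  show "maximal_over I \<nu> x \<le> maximal_over (I \<inter> \<rat>) \<nu> x" (is "_ \<le> ?s")
    unfolding maximal_over_def[of I]
  proof (rule SUP_least)
    fix r assume r: "r \<in> I"
    then have r0: "0 < r" using I(2) by auto
    have le: "emeasure \<nu> (ball x \<rho>) \<le> ?s * emeasure \<mu> (ball x r)" if "\<rho> \<in> I \<inter> \<rat>" "\<rho> < r" for \<rho>
    proof -
      have \<rho>: "0 < \<rho>" using that I(2) by auto
      have "emeasure \<nu> (ball x \<rho>) / emeasure \<mu> (ball x \<rho>) \<le> ?s"
        unfolding maximal_over_def using that(1) by (rule SUP_upper)
      then have "emeasure \<nu> (ball x \<rho>) \<le> ?s * emeasure \<mu> (ball x \<rho>)"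
        using ball_pos[OF x \<rho>] ball_finite[OF x \<rho>] by (simp add: divide_le_ennreal_iff)
      also have "\<dots> \<le> ?s * emeasure \<mu> (ball x r)"
        using that(2) ball_sets[OF sets_\<mu> x r0] by (intro mult_left_mono emeasure_mono ball_mono) auto
      finally show ?thesis .
    qed
    have "emeasure \<nu> (ball x r) \<le> ?s * emeasure \<mu> (ball x r)"
    proof (rule ccontr)
      assume "\<not> ?thesis"
      then have "eventually (\<lambda>\<rho>. ?s * emeasure \<mu> (ball x r) < emeasure \<nu> (ball x \<rho>)) (at_left r)"
        by (intro order_tendstoD(1)[OF emeasure_ball_at_left[OF \<nu> x r0]]) simp
      moreover have "eventually (\<lambda>\<rho>. \<rho> \<in> I) (at_left r)"
        using I(1) r by (auto simp: eventually_at_topological)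
      ultimately have "eventually (\<lambda>\<rho>. \<rho> \<in> I \<and> ?s * emeasure \<mu> (ball x r) < emeasure \<nu> (ball x \<rho>)) (at_left r)"
        by (simp add: eventually_conj_iff)
      then obtain b where b: "b < r"
        "\<And>\<rho>. b < \<rho> \<Longrightarrow> \<rho> < r \<Longrightarrow> \<rho> \<in> I \<and> ?s * emeasure \<mu> (ball x r) < emeasure \<nu> (ball x \<rho>)"
        by (auto simp: eventually_at_left_field)
      obtain \<rho> where "\<rho> \<in> \<rat>" "b < \<rho>" "\<rho> < r"
        using Rats_dense_in_real[OF b(1)] by blast
      with b(2)[of \<rho>] le[of \<rho>] show False by auto
    qed
    then show "emeasure \<nu> (ball x r) / emeasure \<mu> (ball x r) \<le> ?s"
      using ball_pos[OF x r0] ball_finite[OF x r0] by (simp add: divide_le_ennreal_iff)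
  qed
qed

lemma borel_measurable_maximal_over:
  assumes \<nu>: "sets \<nu> = sets (qborel X d)" and I: "open I" "I \<subseteq> {0<..}"
  shows "maximal_over I \<nu> \<in> borel_measurable \<mu>"
proof -
  have "maximal_over (I \<inter> \<rat>) \<nu> \<in> borel_measurable \<mu>"
    unfolding maximal_over_def
    using I(2) by (intro borel_measurable_SUP borel_measurable_divide_ennreal
        borel_measurable_emeasure_ball \<nu> sets_\<mu> countable_Int2 countable_rat) auto
  then show ?thesis
    using maximal_over_Rats[OF \<nu> _ I] space_borel[OF sets_\<mu>]
    by (subst measurable_cong[where g = "maximal_over (I \<inter> \<rat>) \<nu>"]) auto
qed

section \<open>Local and large-scale parts of the maximal function\<close>

text \<open>
  Each point \<open>z\<close> of the level set is the centre of a ball of some radius \<open>\<rho>\<^sub>z < r\<close> with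
  \<open>t \<mu> \<le> \<nu>\<close> on it. The Vitali selection yields countably many disjoint ones whose
  dilates by \<open>3 K\<close> cover the level set; doubling bounds the \<open>\<mu>\<close>-measure of the dilates,
  and disjointness lets the \<open>\<nu>\<close>-measures add up inside the ball of radius \<open>2 K r\<close>.
\<close>
lemma weak_type_local_maximal:
  obtains D where "0 < D"
    "\<And>\<nu> x r t. sets \<nu> = sets (qborel X d) \<Longrightarrow> x \<in> X \<Longrightarrow> 0 < r \<Longrightarrow>
      ennreal t * emeasure \<mu> {z \<in> ball x r. ennreal t < maximal_over {0<..<r} \<nu> z}
        \<le> ennreal D * emeasure \<nu> (ball x (2 * K * r))"
proof -
  obtain D where D: "0 < D" "\<And>x r. x \<in> X \<Longrightarrow> 0 < r \<Longrightarrow>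
      emeasure \<mu> (ball x ((3 * K) * r)) \<le> ennreal D * emeasure \<mu> (ball x r)"
    by (rule doubling_dilation[of "3 * K"]) (rule that)
  show thesis
  proof (rule that[OF D(1)])
    fix \<nu> x r t
    assume \<nu>: "sets \<nu> = sets (qborel X d)" and x: "x \<in> X" and r: "(0::real) < r"
    define E where "E = {z \<in> ball x r. ennreal t < maximal_over {0<..<r} \<nu> z}"
    let ?S = "ball x (2 * K * r)"
    have Kr: "0 < 2 * K * r" using K r by simp
    have EX: "z \<in> X" "d z x \<le> r" if "z \<in> E" for z
      using that x by (auto simp: E_def qball_def dist_sym)
    have "\<exists>\<rho>. 0 < \<rho> \<and> \<rho> < r \<and> ennreal t * emeasure \<mu> (ball z \<rho>) \<le> emeasure \<nu> (ball z \<rho>)"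
      if z: "z \<in> E" for z
    proof -
      obtain \<rho> where \<rho>: "0 < \<rho>" "\<rho> < r" "ennreal t < emeasure \<nu> (ball z \<rho>) / emeasure \<mu> (ball z \<rho>)"
        using z unfolding E_def maximal_over_def by (auto simp: less_SUP_iff)
      then have "ennreal t * emeasure \<mu> (ball z \<rho>) < emeasure \<nu> (ball z \<rho>)"
        using ball_pos[OF EX(1)[OF z] \<rho>(1)] ball_finite[OF EX(1)[OF z] \<rho>(1)]
        by (simp add: divide_le_ennreal_iff not_le[symmetric])
      then show ?thesis using \<rho> by (intro exI[of _ \<rho>]) auto
    qed
    then obtain \<rho> where \<rho>: "\<And>z. z \<in> E \<Longrightarrow> 0 < \<rho> z" "\<And>z. z \<in> E \<Longrightarrow> \<rho> z < r"
      "\<And>z. z \<in> E \<Longrightarrow> ennreal t * emeasure \<mu> (ball z (\<rho> z)) \<le> emeasure \<nu> (ball z (\<rho> z))"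
      by metis
    define B where "B z = ball z (\<rho> z)" for z
    have bdd: "bdd_above (\<rho> ` E)"
      using \<rho>(2) by (intro bdd_aboveI2[of _ _ r]) (simp add: less_imp_le)
    have ne: "B z \<noteq> {}" if "z \<in> E" for z
      using center_in_ball[OF EX(1)[OF that] \<rho>(1)[OF that]] by (auto simp: B_def)
    obtain J where J: "J \<subseteq> E" "disjoint_family_on B J"
      "\<And>z. z \<in> E \<Longrightarrow> \<exists>j\<in>J. B z \<inter> B j \<noteq> {} \<and> \<rho> z \<le> 2 * \<rho> j"
      using Vitali_selection[of E \<rho> B] \<rho>(1) bdd ne by blast
    have JX: "j \<in> X" "0 < \<rho> j" if "j \<in> J" for j
      using that J(1) EX \<rho>(1) by auto
    have B_sets: "B j \<in> sets N" if "sets N = sets (qborel X d)" "j \<in> J" for N j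
      unfolding B_def using that JX by (intro ball_sets)
    have B_sub: "B j \<subseteq> ?S" if "j \<in> J" for j
    proof -
      have "j \<in> E" using that J(1) by auto
      then have "K * (r + \<rho> j) \<le> K * (2 * r)"
        using K \<rho>(2)[of j] by (intro mult_left_mono) auto
      then show ?thesis
        unfolding B_def using EX[OF \<open>j \<in> E\<close>] x by (intro ball_subset) auto
    qed
    have count: "countable J"
      using B_sets[OF sets_\<mu>] J(2) B_sub ball_pos JX
        ball_sets[OF sets_\<mu> x Kr] ball_finite[OF x Kr]
      by (intro countable_disjoint_family_pos_measure[of J B \<mu> ?S]) (auto simp: B_def)
    have dil_sets: "ball j (3 * K * \<rho> j) \<in> sets \<mu>" if "j \<in> J" for j
      using JX[OF that] K by (intro ball_sets[OF sets_\<mu>]) auto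
    \<comment> \<open>If \<open>u\<close> is common to both balls and \<open>\<rho>\<^sub>z \<le> 2 \<rho>\<^sub>j\<close>, then
      \<open>d j z < K (\<rho>\<^sub>j + 2 \<rho>\<^sub>j)\<close>. It suffices to cover the centres \<open>z\<close>.\<close>
    have cover: "E \<subseteq> (\<Union>j\<in>J. ball j (3 * K * \<rho> j))"
    proof
      fix z assume z: "z \<in> E"
      then obtain j u where j: "j \<in> J" "\<rho> z \<le> 2 * \<rho> j" and u: "u \<in> B z" "u \<in> B j"
        using J(3) by blast
      have "d j z \<le> K * (d j u + d u z)"
        using dist_triangle[of j z u] JX(1)[OF j(1)] EX(1)[OF z] u by (simp add: B_def qball_def)
      also have "\<dots> < K * (\<rho> j + 2 * \<rho> j)"
        using u j(2) K EX(1)[OF z] dist_sym[of u z]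
        by (intro mult_strict_left_mono) (auto simp: B_def qball_def)
      finally show "z \<in> (\<Union>j\<in>J. ball j (3 * K * \<rho> j))"
        using j(1) EX(1)[OF z] by (intro UN_I[of j]) (auto simp: qball_def)
    qed
    have "emeasure \<mu> E \<le> emeasure \<mu> (\<Union>j\<in>J. ball j (3 * K * \<rho> j))"
      using cover dil_sets count by (intro emeasure_mono sets.countable_UN') auto
    also have "\<dots> \<le> (\<integral>\<^sup>+j. emeasure \<mu> (ball j (3 * K * \<rho> j)) \<partial>count_space J)"
      using dil_sets count by (rule emeasure_UN_countable_le)
    finally have "ennreal t * emeasure \<mu> E
        \<le> ennreal t * (\<integral>\<^sup>+j. emeasure \<mu> (ball j (3 * K * \<rho> j)) \<partial>count_space J)"
      by (rule mult_left_mono) simp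
    also have "\<dots> = (\<integral>\<^sup>+j. ennreal t * emeasure \<mu> (ball j (3 * K * \<rho> j)) \<partial>count_space J)"
      by (simp add: nn_integral_cmult)
    also have "\<dots> \<le> (\<integral>\<^sup>+j. ennreal D * emeasure \<nu> (B j) \<partial>count_space J)"
    proof (rule nn_integral_mono)
      fix j assume "j \<in> space (count_space J)"
      then have j: "j \<in> J" by simp
      have "ennreal t * emeasure \<mu> (ball j (3 * K * \<rho> j)) \<le> ennreal t * (ennreal D * emeasure \<mu> (B j))"
        unfolding B_def using D(2) JX[OF j] by (intro mult_left_mono) auto
      also have "\<dots> = ennreal D * (ennreal t * emeasure \<mu> (B j))"
        by (simp add: mult_ac)
      also have "\<dots> \<le> ennreal D * emeasure \<nu> (B j)"
        unfolding B_def using \<rho>(3) J(1) j by (intro mult_left_mono) auto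
      finally show "ennreal t * emeasure \<mu> (ball j (3 * K * \<rho> j)) \<le> ennreal D * emeasure \<nu> (B j)" .
    qed
    also have "\<dots> = ennreal D * emeasure \<nu> (\<Union>j\<in>J. B j)"
      using B_sets[OF \<nu>] count J(2) by (simp add: nn_integral_cmult emeasure_UN_countable)
    also have "\<dots> \<le> ennreal D * emeasure \<nu> ?S"
      using B_sub ball_sets[OF \<nu> x Kr] by (intro mult_left_mono emeasure_mono) auto
    finally show "ennreal t * emeasure \<mu> {z \<in> ball x r. ennreal t < maximal_over {0<..<r} \<nu> z}
        \<le> ennreal D * emeasure \<nu> ?S"
      unfolding E_def .
  qed
qed

text \<open>
  The ball about \<open>x\<close> of radius \<open>2 K r\<close> lies in the one about \<open>y\<close> of radius \<open>c r\<close>, which in turn lies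
  in the one about \<open>x\<close> of radius \<open>c' r\<close>; doubling compares the latter with radius \<open>r\<close>. The dilation
  by \<open>2 K\<close> in the numerator is what lets the lemma serve both for the balls of large radius and for
  the quotient left over by the weak type bound.
\<close>
lemma ball_ratio_le_maximal_function:
  obtains D where "0 < D"
    "\<And>\<nu> x y r. sets \<nu> = sets (qborel X d) \<Longrightarrow> x \<in> X \<Longrightarrow> y \<in> X \<Longrightarrow> 0 < r \<Longrightarrow> d x y \<le> 2 * K * r \<Longrightarrow>
      emeasure \<nu> (ball x (2 * K * r)) / emeasure \<mu> (ball x r) \<le> ennreal D * maximal_function X d \<mu> \<nu> y"
proof -
  define c where "c = K * (4 * K)"
  define c' where "c' = K * (2 * K + c)"
  obtain D where D: "0 < D" "\<And>x r. x \<in> X \<Longrightarrow> 0 < r \<Longrightarrow>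
      emeasure \<mu> (ball x (c' * r)) \<le> ennreal D * emeasure \<mu> (ball x r)"
    by (rule doubling_dilation[of c']) (rule that)
  show thesis
  proof (rule that[OF D(1)])
    fix \<nu> x y r
    assume \<nu>: "sets \<nu> = sets (qborel X d)" and x: "x \<in> X" and y: "y \<in> X" and r: "(0::real) < r"
      and xy: "d x y \<le> 2 * K * r"
    let ?M = "maximal_function X d \<mu> \<nu> y"
    have c: "0 < c" and c': "0 < c'" using K by (auto simp: c_def c'_def add_pos_pos)
    have cr: "0 < c * r" and c'r: "0 < c' * r" using c c' r by auto
    have sub1: "ball x (2 * K * r) \<subseteq> ball y (c * r)"
      using x y xy by (intro ball_subset) (auto simp: c_def algebra_simps)
    have sub2: "ball y (c * r) \<subseteq> ball x (c' * r)"
      using x y xy by (intro ball_subset) (auto simp: c'_def algebra_simps dist_sym)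
    have "emeasure \<nu> (ball x (2 * K * r)) \<le> emeasure \<nu> (ball y (c * r))"
      by (rule emeasure_mono[OF sub1 ball_sets[OF \<nu> y cr]])
    also have "\<dots> \<le> ?M * emeasure \<mu> (ball y (c * r))"
    proof -
      have "emeasure \<nu> (ball y (c * r)) / emeasure \<mu> (ball y (c * r)) \<le> ?M"
        unfolding maximal_function_def using cr by (intro SUP_upper) auto
      then show ?thesis
        using ball_pos[OF y cr] ball_finite[OF y cr] by (simp add: divide_le_ennreal_iff)
    qed
    also have "\<dots> \<le> ?M * emeasure \<mu> (ball x (c' * r))"
      by (intro mult_left_mono emeasure_mono[OF sub2 ball_sets[OF sets_\<mu> x c'r]]) simp
    also have "\<dots> \<le> ?M * (ennreal D * emeasure \<mu> (ball x r))"
      by (intro mult_left_mono D(2) x r) simp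
    also have "\<dots> = (ennreal D * ?M) * emeasure \<mu> (ball x r)"
      by (simp add: mult_ac)
    finally show "emeasure \<nu> (ball x (2 * K * r)) / emeasure \<mu> (ball x r) \<le> ennreal D * ?M"
      using ball_pos[OF x r] ball_finite[OF x r] by (simp add: divide_le_ennreal_iff)
  qed
qed

text \<open>
  This averages \<open>M\<^sub>\<mu>\<nu>(z)\<^sup>p \<le> f(z)\<^sup>p + (H M\<^sub>\<mu>\<nu>(y))\<^sup>p\<close> over \<open>z\<close> in the ball, where \<open>f\<close> is the local
  part and the mean of \<open>f\<^sup>p\<close> is controlled by Kolmogorov's inequality. The constant depends neither
  on the ball nor on \<open>y\<close>.
\<close>
lemma maximal_function_powr_average_le:
  assumes \<nu>: "sets \<nu> = sets (qborel X d)"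
    and \<nu>_finite: "\<And>x r. x \<in> X \<Longrightarrow> 0 < r \<Longrightarrow> emeasure \<nu> (ball x r) < \<infinity>"
    and p: "0 < p" "p < 1"
  obtains C where "0 \<le> C"
    "\<And>x r y. x \<in> X \<Longrightarrow> 0 < r \<Longrightarrow> y \<in> ball x r \<Longrightarrow>
      (\<integral>\<^sup>+z\<in>ball x r. ennreal_powr (maximal_function X d \<mu> \<nu> z) p \<partial>\<mu>) / emeasure \<mu> (ball x r)
        \<le> ennreal C * ennreal_powr (maximal_function X d \<mu> \<nu> y) p"
proof -
  let ?M = "maximal_function X d \<mu> \<nu>"
  obtain D where D: "0 < D"
    "\<And>x r t. x \<in> X \<Longrightarrow> 0 < r \<Longrightarrow>
      ennreal t * emeasure \<mu> {z \<in> ball x r. ennreal t < maximal_over {0<..<r} \<nu> z}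
        \<le> ennreal D * emeasure \<nu> (ball x (2 * K * r))"
    by (rule weak_type_local_maximal) (rule that[OF _ _], use \<nu> in auto)
  obtain H where H: "0 < H"
    "\<And>x y r. x \<in> X \<Longrightarrow> y \<in> X \<Longrightarrow> 0 < r \<Longrightarrow> d x y \<le> 2 * K * r \<Longrightarrow>
      emeasure \<nu> (ball x (2 * K * r)) / emeasure \<mu> (ball x r) \<le> ennreal H * ?M y"
    by (rule ball_ratio_le_maximal_function) (rule that[OF _ _], use \<nu> in auto)
  define c where "c = 1 + D * 2 powr p / (1 - 2 powr (p - 1))"
  have c: "0 \<le> c"
    using D(1) p powr_less_mono[of "p - 1" 0 2] by (simp add: c_def)
  show thesis
  proof (rule that[of "(c + 1) * H powr p"])
    show "0 \<le> (c + 1) * H powr p" using c by simp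
    fix x r y assume x: "x \<in> X" and r: "(0::real) < r" and y: "y \<in> ball x r"
    let ?B = "ball x r" and ?f = "maximal_over {0<..<r} \<nu>"
    have Kr: "0 < 2 * K * r" using K r by auto
    have "d x y < r" using y by (simp add: qball_def)
    then have dxy: "d x y \<le> 2 * K * r" using mult_right_mono[of 1 K r] K r by linarith
    have yX: "y \<in> X" using y by (simp add: qball_def)
    have B [measurable]: "?B \<in> sets \<mu>" by (intro ball_sets sets_\<mu> x r)
    have f [measurable]: "?f \<in> borel_measurable \<mu>"
      using \<nu> by (rule borel_measurable_maximal_over) auto
    have pos: "0 < emeasure \<mu> ?B" and fin: "emeasure \<mu> ?B < \<infinity>"
      using ball_pos ball_finite x r by auto
    \<comment> \<open>Radii below \<open>r\<close> are seen by \<open>?f\<close>; larger ones compare with the value at \<open>y\<close>.\<close>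
    have near: "?M z \<le> max (?f z) (ennreal H * ?M y)" if z: "z \<in> ?B" for z
      unfolding maximal_function_def[of _ _ _ _ z]
    proof (rule SUP_least)
      fix \<rho> :: real assume "\<rho> \<in> {0<..}"
      then have \<rho>: "0 < \<rho>" by simp
      have zX: "z \<in> X" using z by (simp add: qball_def)
      let ?q = "emeasure \<nu> (ball z \<rho>) / emeasure \<mu> (ball z \<rho>)"
      show "?q \<le> max (?f z) (ennreal H * ?M y)"
      proof (cases "\<rho> < r")
        case True
        then have "?q \<le> ?f z"
          unfolding maximal_over_def using \<rho> by (intro SUP_upper) auto
        then show ?thesis by (simp add: le_max_iff_disj)
      next
        case False
        have K\<rho>: "\<rho> \<le> 2 * K * \<rho>" "K * r \<le> K * \<rho>"
          using K \<rho> False by (auto intro: mult_left_mono)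
        have "d z y \<le> K * (d z x + d x y)"
          using dist_triangle[of z y x] zX yX x by simp
        also have "\<dots> \<le> K * (r + r)"
          using z y x zX K by (intro mult_left_mono) (auto simp: qball_def dist_sym)
        also have "\<dots> \<le> 2 * K * \<rho>" using K\<rho>(2) by (simp add: algebra_simps)
        finally have dzy: "d z y \<le> 2 * K * \<rho>" .
        have "?q \<le> emeasure \<nu> (ball z (2 * K * \<rho>)) / emeasure \<mu> (ball z \<rho>)"
          using K\<rho> \<rho> zX
          by (intro divide_right_mono_ennreal emeasure_mono ball_mono ball_sets[OF \<nu>]) auto
        also have "\<dots> \<le> ennreal H * ?M y"
          by (rule H(2)[OF zX yX \<rho> dzy])
        finally show ?thesis by (simp add: le_max_iff_disj)
      qed
    qed
    define Q where "Q = ennreal (H powr p) * ennreal_powr (?M y) p"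
    have Q_eq: "Q = ennreal_powr (ennreal H * ?M y) p"
      unfolding Q_def using H(1) by (simp add: ennreal_powr_mult_left)
    have local: "(\<integral>\<^sup>+z\<in>?B. ennreal_powr (?f z) p \<partial>\<mu>) \<le> ennreal c * Q * emeasure \<mu> ?B"
    \<comment> \<open>Kolmogorov's inequality is applied with \<open>L = \<nu>(B\<^sup>*) / \<mu>(B)\<close>, which must be positive;
      if \<open>\<nu>(B\<^sup>*) = 0\<close>, the local part vanishes on the ball.\<close>
    proof (cases "emeasure \<nu> (ball x (2 * K * r)) = 0")
      case True
      have zero: "?f z = 0" if z: "z \<in> ?B" for z
      proof -
        have "emeasure \<nu> (ball z \<rho>) = 0" if "0 < \<rho>" "\<rho> < r" for \<rho>
        proof -
          have "K * (r + \<rho>) \<le> K * (r + r)"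
            using that K by (intro mult_left_mono) auto
          then have "ball z \<rho> \<subseteq> ball x (2 * K * r)"
            using z x by (intro ball_subset[of z x r]) (auto simp: qball_def dist_sym)
          then have "emeasure \<nu> (ball z \<rho>) \<le> emeasure \<nu> (ball x (2 * K * r))"
            by (rule emeasure_mono[OF _ ball_sets[OF \<nu> x Kr]])
          then show ?thesis using True by simp
        qed
        then show ?thesis
          unfolding maximal_over_def
          by (intro antisym[OF SUP_least]) auto
      qed
      have "(\<integral>\<^sup>+z\<in>?B. ennreal_powr (?f z) p \<partial>\<mu>) = (\<integral>\<^sup>+z. 0 \<partial>\<mu>)"
        using zero p by (intro nn_integral_cong) (auto simp: ennreal_powr_def indicator_def)
      then show ?thesis by simp
    next
      case False
      obtain n where n: "emeasure \<nu> (ball x (2 * K * r)) = ennreal n" "0 \<le> n"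
        using \<nu>_finite[OF x Kr] by (cases "emeasure \<nu> (ball x (2 * K * r))") auto
      obtain m where m: "emeasure \<mu> ?B = ennreal m" "0 \<le> m"
        using fin by (cases "emeasure \<mu> ?B") auto
      have "0 < m" "0 < n" using n m pos False by (auto simp: less_le)
      define L where "L = n / m"
      have L: "0 < L" using \<open>0 < m\<close> \<open>0 < n\<close> by (simp add: L_def)
      have "(\<integral>\<^sup>+z\<in>?B. ennreal_powr (?f z) p \<partial>\<mu>) \<le> ennreal (c * L powr p) * emeasure \<mu> ?B"
        unfolding c_def
      proof (rule Kolmogorov_inequality[OF f B fin p L])
        show "0 \<le> D" using D(1) by simp
        fix t :: real
        show "ennreal t * emeasure \<mu> {z \<in> ?B. ennreal t < ?f z} \<le> ennreal (D * L) * emeasure \<mu> ?B"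
          using D(2)[OF x r, of t] D(1) n m \<open>0 < m\<close> by (simp add: L_def ennreal_mult[symmetric])
      qed
      also have "ennreal (c * L powr p) = ennreal c * ennreal_powr (ennreal L) p"
        using c p L by (simp add: ennreal_mult ennreal_powr_ennreal)
      also have "ennreal L \<le> ennreal H * ?M y"
        using H(2)[OF x yX r dxy] n m \<open>0 < m\<close> by (simp add: L_def divide_ennreal)
      then have "ennreal c * ennreal_powr (ennreal L) p * emeasure \<mu> ?B \<le> ennreal c * Q * emeasure \<mu> ?B"
        unfolding Q_eq using p by (intro mult_right_mono mult_left_mono ennreal_powr_mono) auto
      finally show ?thesis .
    qed
    have "(\<integral>\<^sup>+z\<in>?B. ennreal_powr (?M z) p \<partial>\<mu>)
        \<le> (\<integral>\<^sup>+z. ennreal_powr (?f z) p * indicator ?B z + Q * indicator ?B z \<partial>\<mu>)"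
    proof (rule nn_integral_mono)
      fix z
      show "ennreal_powr (?M z) p * indicator ?B z
        \<le> ennreal_powr (?f z) p * indicator ?B z + Q * indicator ?B z"
      proof (cases "z \<in> ?B")
        case True
        have "ennreal_powr (?M z) p \<le> ennreal_powr (max (?f z) (ennreal H * ?M y)) p"
          using p near[OF True] by (intro ennreal_powr_mono) auto
        also have "\<dots> \<le> ennreal_powr (?f z) p + Q"
          unfolding Q_eq by (rule ennreal_powr_max_le)
        finally show ?thesis using True by simp
      qed simp
    qed
    also have "\<dots> = (\<integral>\<^sup>+z\<in>?B. ennreal_powr (?f z) p \<partial>\<mu>) + Q * emeasure \<mu> ?B"
      by (simp add: nn_integral_add nn_integral_cmult_indicator)
    also have "\<dots> \<le> ennreal c * Q * emeasure \<mu> ?B + Q * emeasure \<mu> ?B"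
      by (intro add_right_mono local)
    also have "\<dots> = (ennreal ((c + 1) * H powr p) * ennreal_powr (?M y) p) * emeasure \<mu> ?B"
      using c by (simp add: Q_def ennreal_mult distrib_left distrib_right mult_ac)
    finally show "(\<integral>\<^sup>+z\<in>?B. ennreal_powr (?M z) p \<partial>\<mu>) / emeasure \<mu> ?B
        \<le> ennreal ((c + 1) * H powr p) * ennreal_powr (?M y) p"
      using pos fin by (simp add: divide_le_ennreal_iff)
  qed
qed

end

section \<open>Powers of maximal functions are Muckenhoupt weights\<close>

lemma homogeneous_type_imp_doubling_space:
  assumes hom: "homogeneous_type X d \<mu>"
    and op: "\<And>x r. x \<in> X \<Longrightarrow> 0 < r \<Longrightarrow> openin (qtopology X d) (qball X d x r)"
  obtains K A where "doubling_space X d \<mu> K A"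
proof -
  have qd: "quasi_distance X d" and \<mu>: "sets \<mu> = sets (qborel X d)"
    using hom by (simp_all add: homogeneous_type_def borel_measure_on_def)
  obtain K where K: "1 \<le> K"
    "\<forall>x\<in>X. \<forall>y\<in>X. \<forall>z\<in>X. d x y \<le> K * (d x z + d z y)"
    using qd unfolding quasi_distance_def by (elim conjE exE)
  obtain A where A: "\<forall>x\<in>X. \<forall>r>0.
        0 < emeasure \<mu> (qball X d x (2 * r)) \<and>
        emeasure \<mu> (qball X d x (2 * r)) \<le> ennreal A * emeasure \<mu> (qball X d x r) \<and>
        ennreal A * emeasure \<mu> (qball X d x r) < \<infinity>"
    using hom unfolding homogeneous_type_def by (elim conjE exE)
  have "doubling_space X d \<mu> K A"
  proof
    fix x r assume x: "x \<in> X" and r: "(0::real) < r"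
    show "emeasure \<mu> (qball X d x (2 * r)) \<le> ennreal A * emeasure \<mu> (qball X d x r)"
      using A x r by simp
    have half: "0 < emeasure \<mu> (qball X d x r)"
      "emeasure \<mu> (qball X d x r) \<le> ennreal A * emeasure \<mu> (qball X d x (r / 2))"
      "ennreal A * emeasure \<mu> (qball X d x (r / 2)) < \<infinity>"
      using A[rule_format, OF x, of "r / 2"] r by simp_all
    show "0 < emeasure \<mu> (qball X d x r)" by (rule half)
    show "emeasure \<mu> (qball X d x r) < \<infinity>" using half(2,3) by (rule order.strict_trans1)
  qed (use qd K op \<mu> in \<open>simp_all add: quasi_distance_def\<close>)
  then show thesis by (rule that)
qed

theorem theorem3:
  fixes X :: "'a set" and d :: "'a \<Rightarrow> 'a \<Rightarrow> real" and \<mu> \<nu> :: "'a measure" and \<gamma> :: real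
  assumes "homogeneous_type X d \<mu>"
    and "\<And>x r. x \<in> X \<Longrightarrow> 0 < r \<Longrightarrow> openin (qtopology X d) (qball X d x r)"
    and "borel_measure_on X d \<nu>"
    and "\<And>x r. x \<in> X \<Longrightarrow> 0 < r \<Longrightarrow> emeasure \<nu> (qball X d x r) < \<infinity>"
    and "AE x in \<mu>. maximal_function X d \<mu> \<nu> x < \<infinity>"
    and "0 \<le> \<gamma>" and "\<gamma> < 1"
  shows "(\<lambda>x. ennreal_powr (maximal_function X d \<mu> \<nu> x) \<gamma>) \<in> A1 X d \<mu>"
proof -
  obtain K A where "doubling_space X d \<mu> K A"
    using homogeneous_type_imp_doubling_space[OF assms(1,2)] .
  then interpret doubling_space X d \<mu> K A .
  have \<nu>: "sets \<nu> = sets (qborel X d)"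
    using assms(3) by (simp add: borel_measure_on_def)
  let ?w = "\<lambda>x. ennreal_powr (maximal_function X d \<mu> \<nu> x) \<gamma>"
  have M [measurable]: "maximal_function X d \<mu> \<nu> \<in> borel_measurable \<mu>"
    unfolding maximal_function_eq by (rule borel_measurable_maximal_over[OF \<nu>]) auto
  obtain C where C: "0 \<le> C" "\<And>x r y. x \<in> X \<Longrightarrow> 0 < r \<Longrightarrow> y \<in> ball x r \<Longrightarrow>
      (\<integral>\<^sup>+z\<in>ball x r. ?w z \<partial>\<mu>) / emeasure \<mu> (ball x r) \<le> ennreal C * ?w y"
  proof (cases "\<gamma> = 0")
    case True
    show thesis
    proof (rule that[of 1])
      fix x r y assume x: "x \<in> X" and r: "(0::real) < r"
      show "(\<integral>\<^sup>+z\<in>ball x r. ?w z \<partial>\<mu>) / emeasure \<mu> (ball x r) \<le> ennreal 1 * ?w y"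
        using ball_sets[OF sets_\<mu> x r] ball_pos[OF x r] ball_finite[OF x r]
        by (simp add: True ennreal_powr_def)
    qed simp
  next
    case False
    have "0 < \<gamma>" using False assms(6) by simp
    show thesis
      by (rule maximal_function_powr_average_le[OF \<nu> assms(4) \<open>0 < \<gamma>\<close> assms(7)])
        (assumption | rule that)+
  qed
  have "(\<integral>\<^sup>+z\<in>ball x r. ?w z \<partial>\<mu>) < \<infinity>" if x: "x \<in> X" and r: "0 < r" for x r
  proof -
    have "\<exists>y\<in>ball x r. maximal_function X d \<mu> \<nu> y < \<infinity>"
    proof (rule ccontr)
      assume "\<not> ?thesis"
      then have "AE y in \<mu>. y \<notin> ball x r"
        using assms(5) by (auto elim!: eventually_mono)
      then have "emeasure \<mu> (ball x r) = 0"
        using ball_sets[OF sets_\<mu> x r] AE_iff_measurable[of "ball x r" \<mu> "\<lambda>y. y \<notin> ball x r"]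
          space_borel[OF sets_\<mu>] by (auto simp: qball_def)
      then show False using ball_pos[OF x r] by simp
    qed
    then obtain y where y: "y \<in> ball x r" "maximal_function X d \<mu> \<nu> y < \<infinity>" by blast
    have "(\<integral>\<^sup>+z\<in>ball x r. ?w z \<partial>\<mu>) \<le> ennreal C * ?w y * emeasure \<mu> (ball x r)"
      using C(2)[OF x r y(1)] ball_pos[OF x r] ball_finite[OF x r] by (simp add: divide_le_ennreal_iff)
    also have "\<dots> < \<infinity>"
      using y(2) ball_finite[OF x r] by (auto simp: ennreal_mult_less_top ennreal_powr_def)
    finally show ?thesis .
  qed
  then show ?thesis
    unfolding A1_def weight_def using C by (auto intro!: exI[of _ C])
qed

end
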